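(* Let $d\ge 2$ and let $A$ be an irreducible $k\times k$ matrix with entries in $\{0,1\}$, indexed by $\mathcal{A}=\{1,\dots,k\}$. Let $\mathsf{X}_A$ be the Markov shift and $\mathcal{T}_A$ the hom Markov tree-shift on the $d$-tree induced by $A$, and let $M=\max_i\sum_j A_{i,j}$ and $m=\min_i\sum_j A_{i,j}$ be the maximal and minimal row sums of $A$. Then $h(\mathsf{X}_A)=h(\mathcal{T}_A)$ if and only if $M=m$.
   Context: $\mathbb{N}=\{1,2,\dots\}$. Let $\Sigma=\{0,1,\dots,d-1\}$, $\Sigma^*=\bigcup_{n\ge0}\Sigma^n$ the set of all finite words over $\Sigma$ (with empty word $\epsilon$), and $\Delta_n=\bigcup_{i=0}^n\Sigma^i$. A labeled tree is a function $t:\Sigma^*\to\mathcal{A}$, $w\mapsto t_w$. An $n$-block is a function $u:\Delta_n\to\mathcal{A}$; it appears in $t$ if there is $s\in\Sigma^*$ with $t_{sw}=u_w$ for all $w\in\Delta_n$. A square binary matrix $A$ is irreducible if for all indices $i,j$ there is $n\ge1$ with $(A^n)_{i,j}>0$. $\mathsf{X}_A=\{x\in\mathcal{A}^{\mathbb{N}}: A_{x_i,x_{i+1}}=1\ \forall i\in\mathbb{N}\}$ and $\mathcal{T}_A=\{t\in\mathcal{A}^{\Sigma^*}: A_{t_w,t_{wi}}=1\ \forall w\in\Sigma^*, i\in\Sigma\}$. $B_n(\mathsf{X}_A)=\{x_1\cdots x_n: x\in\mathsf{X}_A\}$, and $B_n(\mathcal{T}_A)$ is the set of $n$-blocks appearing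 in elements of $\mathcal{T}_A$. The topological entropies are $h(\mathsf{X}_A)=\lim_{n\to\infty}\frac{\log|B_n(\mathsf{X}_A)|}{n}$ and $h(\mathcal{T}_A)=\lim_{n\to\infty}\frac{\log|B_n(\mathcal{T}_A)|}{|\Delta_n|}$ (both limits are known to exist). *)

theory Defs
  imports Complex_Main "HOL-Library.FuncSet" "Jordan_Normal_Form.Matrix"
begin

text \<open>
  The alphabet of size \<open>k\<close> is \<open>{..<k}\<close> rather than \<open>{1..k}\<close>, so that symbols are
  the row and column indices of a \<open>k \<times> k\<close> matrix; one-sided sequences are likewise
  indexed from \<open>0\<close>.
\<close>

definition irreducible_matrix :: "nat mat \<Rightarrow> bool" where
  "irreducible_matrix A \<longleftrightarrow> square_mat A \<and>
     (\<forall>i<dim_row A. \<forall>j<dim_row A. \<exists>n\<ge>1. (A ^\<^sub>m n) $$ (i, j) > 0)"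


definition markov_shift :: "nat mat \<Rightarrow> (nat \<Rightarrow> nat) set" where
  "markov_shift A = {x \<in> UNIV \<rightarrow> {..<dim_row A}. \<forall>i. A $$ (x i, x (Suc i)) = 1}"

definition shift_blocks :: "nat \<Rightarrow> (nat \<Rightarrow> 'a) set \<Rightarrow> 'a list set" where
  "shift_blocks n X = (\<lambda>x. map x [0..<n]) ` X"

definition shift_entropy :: "(nat \<Rightarrow> 'a) set \<Rightarrow> real" where
  "shift_entropy X = lim (\<lambda>n. ln (real (card (shift_blocks n X))) / real n)"


abbreviation tree_words :: "nat \<Rightarrow> nat list set" where
  "tree_words d \<equiv> lists {..<d}"

definition Delta :: "nat \<Rightarrow> nat \<Rightarrow> nat list set" where
  "Delta d n = {w \<in> tree_words d. length w \<le> n}"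

text \<open>
  Labeled trees and blocks are extensional functions (value \<open>undefined\<close> off their
  domain), so that equality of blocks is equality on \<open>Delta d n\<close> and cardinalities
  count blocks correctly.
\<close>

definition hom_markov_tree_shift :: "nat \<Rightarrow> nat mat \<Rightarrow> (nat list \<Rightarrow> nat) set" where
  "hom_markov_tree_shift d A =
     {t \<in> tree_words d \<rightarrow>\<^sub>E {..<dim_row A}.
        \<forall>w\<in>tree_words d. \<forall>i<d. A $$ (t w, t (w @ [i])) = 1}"

definition block_appears ::
    "nat \<Rightarrow> nat \<Rightarrow> (nat list \<Rightarrow> 'a) \<Rightarrow> (nat list \<Rightarrow> 'a) \<Rightarrow> bool" where
  "block_appears d n u t \<longleftrightarrow> (\<exists>s\<in>tree_words d. \<forall>w\<in>Delta d n. t (s @ w) = u w)"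

definition tree_blocks ::
    "nat \<Rightarrow> nat \<Rightarrow> (nat list \<Rightarrow> 'a) set \<Rightarrow> (nat list \<Rightarrow> 'a) set" where
  "tree_blocks d n T = {u \<in> extensional (Delta d n). \<exists>t\<in>T. block_appears d n u t}"

definition tree_entropy :: "nat \<Rightarrow> (nat list \<Rightarrow> 'a) set \<Rightarrow> real" where
  "tree_entropy d T =
     lim (\<lambda>n. ln (real (card (tree_blocks d n T))) / real (card (Delta d n)))"

end

theory Submission
  imports Defs "HOL-Analysis.Function_Topology"
begin

text \<open>
  Let \<open>a\<close> be the matrix read over the reals, \<open>c\<close> its Perron eigenvalue, and \<open>r\<close>, \<open>l\<close> positive
  right and left eigenvectors. Words starting at a symbol are counted by iterating \<open>a\<close> on the
  constant vector 1, so the entropy of the Markov shift is \<open>ln c\<close>. The number \<open>N n i\<close> of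
  \<open>n\<close>-blocks of the tree-shift with root symbol \<open>i\<close> obeys the nonlinear recursion
  \<open>N (n + 1) i = (\<Sum>j. a i j * N n j) ^ d\<close>, because the \<open>d\<close> branches below the root are
  chosen independently of each other. If all row sums agree they equal \<open>c\<close>, the recursion solves to
  \<open>N n i = c ^ (|Delta_n| - 1)\<close>, and both entropies are \<open>ln c\<close>.

  For the converse let \<open>u n i = ln (N n i) - (|Delta_n| - 1) * ln c\<close>, and average \<open>u n\<close>
  against the weights \<open>l i * r i\<close>, which are stationary for the stochastic matrix
  \<open>a i j * r j / (c * r i)\<close>. Concavity of the logarithm shows that this average \<open>U\<close> satisfies
  \<open>U (n + 1) \<ge> d * U n\<close> with \<open>U 0 = 0\<close> (\<open>U_Suc_ge\<close>). Since \<open>|Delta_n|\<close> itself grows like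
  \<open>d ^ n\<close>, a Jensen gap at one single level is multiplied by \<open>d\<close> at each later level and is
  visible in the entropy of the tree-shift. Hence, if that entropy is \<open>ln c\<close>, Jensen's inequality
  is an equality at all levels. The case of equality
  (\<open>U_Suc_eq\<close>) turns the recursion into a linear one along the edges of the graph: whenever
  \<open>a i j > 0\<close>, the increments \<open>t n = u (n + 1) - u n\<close> satisfy \<open>t (n + 1) i = d * t n j\<close>.
  Walking backwards along edges, a symbol \<open>i\<close> with \<open>t 0 i \<noteq> 0\<close> would yield increments of exact
  order \<open>d ^ n\<close>, whereas all \<open>u n\<close> are \<open>o(d ^ n)\<close>. So \<open>t 0 = 0\<close>; as \<open>t 0 i\<close> is
  \<open>d * (ln (\<Sum>j. a i j) - ln c)\<close>, every row sum is \<open>c\<close>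
  (\<open>vanishing_excess_imp_row_sums\<close>).

  Equality in all Jensen inequalities alone does not suffice: when two classes of symbols
  alternate and each symbol is joined to the whole of the other class, all Jensen gaps vanish
  although the row sums may differ. There the larger entropy comes from the
  root symbols of one class exceeding the average, which is what the increments detect.
\<close>

section \<open>Perron eigenvectors of irreducible nonnegative matrices\<close>

text \<open>
  A vector with \<open>a x \<ge> c x\<close>. The largest \<open>c\<close> that admits one is the Perron eigenvalue
  (the Collatz--Wielandt characterisation).
\<close>

definition subinvariant :: "'a set \<Rightarrow> ('a \<Rightarrow> 'a \<Rightarrow> real) \<Rightarrow> real \<Rightarrow> ('a \<Rightarrow> real) \<Rightarrow> bool" where
  "subinvariant I a c x \<longleftrightarrow>
     (\<forall>i\<in>I. 0 \<le> x i) \<and> (\<exists>i\<in>I. 0 < x i) \<and> (\<forall>i\<in>I. c * x i \<le> (\<Sum>j\<in>I. a i j * x j))"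

text \<open>
  If the inequality \<open>a x \<ge> c x\<close> is strict in every coordinate, \<open>c\<close> can be raised. If it is strict
  in only some of them, irreducibility gives an edge from a tight coordinate \<open>i\<close> to a slack one
  \<open>j\<close>, and increasing \<open>x j\<close> a little makes \<open>i\<close> slack without making any coordinate tight. Repeating
  this removes all tight coordinates.
\<close>

lemma subinvariant_improve:
  fixes a :: "'a \<Rightarrow> 'a \<Rightarrow> real"
  assumes fin: "finite I" and nonneg: "\<And>i j. i \<in> I \<Longrightarrow> j \<in> I \<Longrightarrow> 0 \<le> a i j"
    and cut: "\<And>S. S \<subset> I \<Longrightarrow> S \<noteq> {} \<Longrightarrow> \<exists>i\<in>S. \<exists>j\<in>I - S. 0 < a i j"
    and "subinvariant I a c x"
    and "\<exists>i\<in>I. c * x i < (\<Sum>j\<in>I. a i j * x j)"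
  shows "\<exists>c' y. c < c' \<and> subinvariant I a c' y"
  using assms(4,5)
proof (induction "card {i\<in>I. c * x i = (\<Sum>j\<in>I. a i j * x j)}" arbitrary: x rule: less_induct)
  case less
  define s where "s x i = (\<Sum>j\<in>I. a i j * x j) - c * x i" for x i
  define T where "T = {i\<in>I. s x i = 0}"
  have x0: "\<And>i. i \<in> I \<Longrightarrow> 0 \<le> x i" and s0: "\<And>i. i \<in> I \<Longrightarrow> 0 \<le> s x i"
    using less.prems(1) by (auto simp: subinvariant_def s_def)
  obtain p where p: "p \<in> I" "0 < x p" using less.prems(1) by (auto simp: subinvariant_def)
  show ?case
  proof (cases "T = {}")
    case True
    define e where "e = Min (s x ` I)"
    define X where "X = (\<Sum>i\<in>I. x i)"
    have X: "0 < X" unfolding X_def by (rule sum_pos2[of I p x]) (use x0 p fin in auto)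
    have e: "0 < e" 
    proof -
      have "\<forall>i\<in>I. 0 < s x i" using True s0 by (force simp: T_def less_le)
      then show ?thesis unfolding e_def using fin p by (subst Min_gr_iff) auto
    qed
    have "(c + e / X) * x i \<le> (\<Sum>j\<in>I. a i j * x j)" if i: "i \<in> I" for i
    proof -
      have "x i \<le> X" unfolding X_def by (rule member_le_sum[OF i]) (use x0 fin in auto)
      then have "e / X * x i \<le> e" using e X by (simp add: field_simps)
      also have "e \<le> s x i" unfolding e_def using fin i by simp
      finally show ?thesis by (simp add: s_def algebra_simps)
    qed
    then have "subinvariant I a (c + e / X) x"
      using x0 p by (auto simp: subinvariant_def)
    then show ?thesis using e X by (intro exI[of _ "c + e / X"] exI[of _ x]) auto
  next
    case False
    have "T \<subset> I" using less.prems(2) by (force simp: T_def s_def)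
    then obtain i j where ij: "i \<in> T" "j \<in> I" "j \<notin> T" "0 < a i j" using cut False by blast
    have sj: "0 < s x j" using ij s0[of j] by (auto simp: T_def less_le)
    \<comment> \<open>Raising \<open>x j\<close> by \<open>e\<close> costs coordinate \<open>j\<close> at most \<open>\<bar>c\<bar> * e\<close>, which stays below its slack.\<close>
    define e where "e = s x j / (\<bar>c\<bar> + 1)"
    have e: "0 < e" using sj by (simp add: e_def)
    define y where "y = x(j := x j + e)"
    have y: "(\<Sum>m\<in>I. a l m * y m) = (\<Sum>m\<in>I. a l m * x m) + a l j * e" for l
    proof -
      have "(\<Sum>m\<in>I. a l m * y m) = (\<Sum>m\<in>I. a l m * x m + (if m = j then a l j * e else 0))"
        by (intro sum.cong) (auto simp: y_def algebra_simps)
      then show ?thesis using fin ij by (simp add: sum.distrib)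
    qed
    have sy: "s y l = s x l + a l j * e" if "l \<noteq> j" for l
      using that y by (simp add: s_def y_def)
    have "c * e < s x j"
    proof -
      have "c * e \<le> \<bar>c\<bar> * e" using e by (simp add: mult_right_mono)
      also have "\<dots> < (\<bar>c\<bar> + 1) * e" using e by simp
      finally show ?thesis by (simp add: e_def)
    qed
    moreover have "s y j = s x j + a j j * e - c * e"
      using y by (simp add: s_def y_def algebra_simps)
    moreover have "0 \<le> a j j * e" using nonneg ij e by simp
    ultimately have syj: "0 < s y j" by linarith
    have "i \<noteq> j" using ij by auto
    then have syi: "0 < s y i" using sy[of i] ij e by (auto simp: T_def)
    have iI: "i \<in> I" using ij by (auto simp: T_def)
    have sy0: "0 \<le> s y l \<and> (s y l = 0 \<longrightarrow> s x l = 0)" if l: "l \<in> I" for l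
    proof (cases "l = j")
      case True then show ?thesis using syj by simp
    next
      case False
      have "0 \<le> a l j * e" using nonneg[OF l ij(2)] e by simp
      then show ?thesis using sy[OF False] s0[OF l] by auto
    qed
    have "card {l\<in>I. s y l = 0} < card T"
    proof (rule psubset_card_mono)
      show "finite T" using fin by (simp add: T_def)
      have "{l\<in>I. s y l = 0} \<subseteq> T" using sy0 by (auto simp: T_def)
      moreover have "i \<notin> {l\<in>I. s y l = 0}" using syi by simp
      ultimately show "{l\<in>I. s y l = 0} \<subset> T" using ij by blast
    qed
    then have "card {l\<in>I. c * y l = (\<Sum>m\<in>I. a l m * y m)} < card {l\<in>I. c * x l = (\<Sum>m\<in>I. a l m * x m)}"
    proof -
      have "{l\<in>I. c * z l = (\<Sum>m\<in>I. a l m * z m)} = {l\<in>I. s z l = 0}" for z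
        by (auto simp: s_def)
      then show ?thesis using \<open>card {l\<in>I. s y l = 0} < card T\<close> by (simp add: T_def)
    qed
    moreover have "subinvariant I a c y"
      unfolding subinvariant_def
    proof (intro conjI ballI)
      show "0 \<le> y l" if "l \<in> I" for l using x0[OF that] e by (auto simp: y_def)
      show "\<exists>i\<in>I. 0 < y i" using p e by (intro bexI[of _ p]) (auto simp: y_def)
      show "c * y l \<le> (\<Sum>j\<in>I. a l j * y j)" if "l \<in> I" for l
        using sy0[OF that] by (simp add: s_def)
    qed
    moreover have "\<exists>i\<in>I. c * y i < (\<Sum>j\<in>I. a i j * y j)"
      using syi iI by (auto simp: s_def)
    ultimately show ?thesis by (rule less.hyps)
  qed
qed

lemma compact_unit_cube: "compact {x :: 'a \<Rightarrow> real. \<forall>i. x i \<in> {0..1}}"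
proof -
  have "compactin (product_topology (\<lambda>_::'a. euclidean) UNIV) (\<Pi>\<^sub>E i\<in>UNIV. {0..1::real})"
    by (subst compactin_PiE) auto
  also have "(\<Pi>\<^sub>E i\<in>UNIV. {0..1::real}) = {x :: 'a \<Rightarrow> real. \<forall>i. x i \<in> {0..1}}"
    by (auto simp: PiE_def Pi_def)
  finally show ?thesis by (simp add: euclidean_product_topology)
qed

text \<open>
  Normalising vectors to coordinate sum 1 confines the admissible pairs \<open>(c, x)\<close> with \<open>c \<ge> 0\<close> to
  a compact set, on which the first component attains its maximum. It is positive because the
  constant vector is subinvariant for the smallest row sum.
\<close>

lemma subinvariant_maximal:
  fixes a :: "'a \<Rightarrow> 'a \<Rightarrow> real"
  assumes fin: "finite I" and ne: "I \<noteq> {}"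
    and nonneg: "\<And>i j. i \<in> I \<Longrightarrow> j \<in> I \<Longrightarrow> 0 \<le> a i j"
    and row: "\<And>i. i \<in> I \<Longrightarrow> \<exists>j\<in>I. 0 < a i j"
  obtains c x where "0 < c" "subinvariant I a c x"
    "\<And>c' y. subinvariant I a c' y \<Longrightarrow> c' \<le> c"
proof -
  define B where "B = (\<Sum>i\<in>I. \<Sum>j\<in>I. a i j)"
  define F where "F = {p :: real \<times> ('a \<Rightarrow> real). (\<Sum>i\<in>I. snd p i) = 1 \<and>
     (\<forall>i\<in>I. fst p * snd p i \<le> (\<Sum>j\<in>I. a i j * snd p j))}"
  define K where "K = ({0..B} \<times> {x. \<forall>i. x i \<in> {0..1}}) \<inter> F"
  have cont: "continuous_on UNIV (\<lambda>p :: real \<times> ('a \<Rightarrow> real). snd p i)" for i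
    by (rule continuous_on_product_then_coordinatewise) (intro continuous_intros)
  have "F = {p. (\<Sum>i\<in>I. snd p i) = 1} \<inter> (\<Inter>i\<in>I. {p. fst p * snd p i \<le> (\<Sum>j\<in>I. a i j * snd p j)})"
    by (auto simp: F_def)
  also have "closed \<dots>"
    by (intro closed_Int closed_INT ballI closed_Collect_le closed_Collect_eq continuous_intros cont)
  finally have "compact K"
    unfolding K_def by (intro compact_Int_closed compact_Times compact_unit_cube) auto
  have into_K: "\<exists>x. (c, x) \<in> K" if c: "0 \<le> c" and sub: "subinvariant I a c y" for c y
  proof -
    define Y where "Y = (\<Sum>i\<in>I. y i)"
    define x where "x i = (if i \<in> I then y i / Y else 0)" for i
    have y0: "\<And>i. i \<in> I \<Longrightarrow> 0 \<le> y i" using sub by (auto simp: subinvariant_def)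
    have Y: "0 < Y" using sub fin y0 unfolding Y_def
      by (auto simp: subinvariant_def intro: sum_pos2)
    have x1: "x i \<in> {0..1}" for i
    proof (cases "i \<in> I")
      case True
      then have "y i \<le> Y" unfolding Y_def using y0 fin by (intro member_le_sum) auto
      then show ?thesis using Y y0 True by (auto simp: x_def)
    qed (simp add: x_def)
    have sumx: "(\<Sum>i\<in>I. x i) = 1"
      using Y by (simp add: x_def sum_divide_distrib[symmetric] Y_def)
    have le: "c * x i \<le> (\<Sum>j\<in>I. a i j * x j)" if i: "i \<in> I" for i
    proof -
      have "c * x i = c * y i / Y" using i by (simp add: x_def)
      also have "\<dots> \<le> (\<Sum>j\<in>I. a i j * y j) / Y"
        using sub i Y by (intro divide_right_mono) (auto simp: subinvariant_def)
      also have "\<dots> = (\<Sum>j\<in>I. a i j * x j)" by (simp add: x_def sum_divide_distrib)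
      finally show ?thesis .
    qed
    have "c = (\<Sum>i\<in>I. c * x i)" using sumx by (simp add: sum_distrib_left[symmetric])
    also have "\<dots> \<le> (\<Sum>i\<in>I. \<Sum>j\<in>I. a i j * x j)" by (intro sum_mono le)
    also have "\<dots> \<le> B" unfolding B_def
      using x1 nonneg by (intro sum_mono) (simp add: mult_left_le)
    finally have "(c, x) \<in> K" using c x1 sumx le by (auto simp: K_def F_def)
    then show ?thesis by blast
  qed
  define b where "b = Min ((\<lambda>i. \<Sum>j\<in>I. a i j) ` I)"
  have row_sum: "0 < (\<Sum>j\<in>I. a i j)" if "i \<in> I" for i
    using row[OF that] nonneg[OF that] fin by (auto intro: sum_pos2)
  have b: "0 < b" unfolding b_def using fin ne row_sum by auto
  have sub_b: "subinvariant I a b (\<lambda>_. 1)"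
    using fin ne by (auto simp: subinvariant_def b_def)
  then have "K \<noteq> {}" using into_K[of b] b by auto
  then obtain p where p: "p \<in> K" "\<forall>q\<in>K. fst q \<le> fst p"
    using continuous_attains_sup[OF \<open>compact K\<close> _ continuous_on_fst[OF continuous_on_id]] by auto
  have max: "c' \<le> fst p" if "subinvariant I a c' y" for c' y
  proof (cases "0 \<le> c'")
    case True
    then show ?thesis using into_K[OF _ that] p by force
  next
    case False
    then show ?thesis using p(1) by (auto simp: K_def)
  qed
  show ?thesis
  proof
    show "0 < fst p" using max[OF sub_b] b by simp
    have "\<exists>i\<in>I. 0 < snd p i"
    proof (rule ccontr)
      assume "\<not> ?thesis"
      then have "(\<Sum>i\<in>I. snd p i) \<le> 0" by (intro sum_nonpos) force
      then show False using p(1) by (simp add: K_def F_def)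
    qed
    then show "subinvariant I a (fst p) (snd p)"
      using p(1) by (auto simp: K_def F_def subinvariant_def)
  qed (rule max)
qed

lemma sum_bilinear_swap:
  fixes l r :: "'a \<Rightarrow> real"
  shows "(\<Sum>i\<in>I. l i * (\<Sum>j\<in>I. a i j * r j)) = (\<Sum>j\<in>I. (\<Sum>i\<in>I. l i * a i j) * r j)"
  by (simp only: sum_distrib_left sum_distrib_right mult.assoc) (rule sum.swap)

text \<open>
  Irreducibility is stated as the absence of a proper nonempty set of indices that no edge leaves.
  In this form it is used directly and passes to the transposed matrix by taking complements.
  Rows and columns are nonzero by separate assumptions, since for a one-element index set the cut
  condition is vacuous.
\<close>

locale irreducible_weights =
  fixes I :: "'a set" and a :: "'a \<Rightarrow> 'a \<Rightarrow> real"
  assumes fin: "finite I" and ne: "I \<noteq> {}"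
    and nonneg: "\<And>i j. i \<in> I \<Longrightarrow> j \<in> I \<Longrightarrow> 0 \<le> a i j"
    and row: "\<And>i. i \<in> I \<Longrightarrow> \<exists>j\<in>I. 0 < a i j"
    and col: "\<And>j. j \<in> I \<Longrightarrow> \<exists>i\<in>I. 0 < a i j"
    and cut: "\<And>S. S \<subset> I \<Longrightarrow> S \<noteq> {} \<Longrightarrow> \<exists>i\<in>S. \<exists>j\<in>I - S. 0 < a i j"
begin

text \<open>
  A maximal pair admits no strict coordinate, by the improvement lemma, so \<open>x\<close> is an eigenvector.
  Its zero set is left by no edge and is therefore empty.
\<close>

lemma Perron_eigenvector:
  "\<exists>c x. 0 < c \<and> (\<forall>i\<in>I. 0 < x i) \<and> (\<forall>i\<in>I. (\<Sum>j\<in>I. a i j * x j) = c * x i)"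
proof -
  obtain c x where c: "0 < c" and x: "subinvariant I a c x"
    and max: "\<And>c' y. subinvariant I a c' y \<Longrightarrow> c' \<le> c"
    by (rule subinvariant_maximal[OF fin ne, of a]) (use nonneg row in auto)
  have x0: "\<And>i. i \<in> I \<Longrightarrow> 0 \<le> x i" using x by (simp add: subinvariant_def)
  have "\<not> (\<exists>i\<in>I. c * x i < (\<Sum>j\<in>I. a i j * x j))"
    using subinvariant_improve[of I a, OF fin _ cut x] nonneg max by (meson not_le)
  then have eig: "(\<Sum>j\<in>I. a i j * x j) = c * x i" if "i \<in> I" for i
    using that x by (force simp: subinvariant_def)
  define S where "S = {i\<in>I. x i = 0}"
  have "S = {}"
  proof (rule ccontr)
    assume "S \<noteq> {}"
    moreover have "S \<subset> I" using x by (force simp: S_def subinvariant_def)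
    ultimately obtain i j where ij: "i \<in> S" "j \<in> I" "j \<notin> S" "0 < a i j" using cut by blast
    have "0 < (\<Sum>j\<in>I. a i j * x j)"
      using ij x0 nonneg fin by (intro sum_pos2[of _ j]) (auto simp: S_def less_le)
    then show False using eig[of i] ij by (simp add: S_def)
  qed
  then have "0 < x i" if "i \<in> I" for i using that x0[OF that] by (auto simp: S_def less_le)
  then show ?thesis using c eig by (intro exI[of _ c] exI[of _ x]) auto
qed

lemma transposed: "irreducible_weights I (\<lambda>i j. a j i)"
proof (rule irreducible_weights.intro)
  show "finite I" "I \<noteq> {}" by (rule fin ne)+
  show "0 \<le> a j i" if "i \<in> I" "j \<in> I" for i j using that by (intro nonneg)
  show "\<exists>j\<in>I. 0 < a j i" if "i \<in> I" for i using that by (rule col)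
  show "\<exists>i\<in>I. 0 < a j i" if "j \<in> I" for j using that by (rule row)
  show "\<exists>i\<in>S. \<exists>j\<in>I - S. 0 < a j i" if "S \<subset> I" "S \<noteq> {}" for S
  proof -
    have "I - S \<subset> I" "I - S \<noteq> {}" using that by auto
    from cut[OF this] obtain i j where "i \<in> I" "i \<notin> S" "j \<in> S" "0 < a i j" by auto
    then show ?thesis by (intro bexI[of _ j] bexI[of _ i]) auto
  qed
qed

end

locale Perron_weights = irreducible_weights I a for I :: "'a set" and a +
  fixes c :: real and r l :: "'a \<Rightarrow> real"
  assumes c: "0 < c" and r: "\<And>i. i \<in> I \<Longrightarrow> 0 < r i" and l: "\<And>i. i \<in> I \<Longrightarrow> 0 < l i"
    and right: "\<And>i. i \<in> I \<Longrightarrow> (\<Sum>j\<in>I. a i j * r j) = c * r i"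
    and left: "\<And>j. j \<in> I \<Longrightarrow> (\<Sum>i\<in>I. l i * a i j) = c * l j"

lemma (in irreducible_weights) Perron_weights_exist: "\<exists>c r l. Perron_weights I a c r l"
proof -
  obtain c r where c: "0 < c" and r: "\<forall>i\<in>I. 0 < r i"
    and ar: "\<forall>i\<in>I. (\<Sum>j\<in>I. a i j * r j) = c * r i"
    using Perron_eigenvector by (elim exE conjE) (rule that)
  interpret T: irreducible_weights I "\<lambda>i j. a j i" by (rule transposed)
  obtain c' l where l: "\<forall>i\<in>I. 0 < l i"
    and la: "\<forall>j\<in>I. (\<Sum>i\<in>I. a i j * l i) = c' * l j"
    using T.Perron_eigenvector by (elim exE conjE) (rule that)
  have la': "\<forall>j\<in>I. (\<Sum>i\<in>I. l i * a i j) = c' * l j"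
    using la by (simp add: mult.commute)
  \<comment> \<open>Pairing the two eigenvectors shows that they belong to the same eigenvalue.\<close>
  have "c * (\<Sum>i\<in>I. l i * r i) = (\<Sum>i\<in>I. l i * (c * r i))"
    by (simp only: sum_distrib_left mult.left_commute)
  also have "\<dots> = (\<Sum>i\<in>I. l i * (\<Sum>j\<in>I. a i j * r j))"
    using ar by (intro sum.cong) simp_all
  also have "\<dots> = (\<Sum>j\<in>I. (\<Sum>i\<in>I. l i * a i j) * r j)"
    by (rule sum_bilinear_swap)
  also have "\<dots> = (\<Sum>j\<in>I. c' * l j * r j)"
    using la' by (intro sum.cong) simp_all
  also have "\<dots> = c' * (\<Sum>i\<in>I. l i * r i)"
    by (simp only: sum_distrib_left mult.assoc)
  finally have "c = c'"
    using sum_pos[OF fin ne, of "\<lambda>i. l i * r i"] l r by simp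
  with la' have "\<forall>j\<in>I. (\<Sum>i\<in>I. l i * a i j) = c * l j" by simp
  then have "Perron_weights I a c r l"
    by unfold_locales (use c r l ar in auto)
  then show ?thesis by blast
qed

section \<open>Growth of the block counts\<close>

text \<open>
  For a 0-1 matrix this is the number of \<open>n\<close>-blocks on the \<open>d\<close>-tree with a given root symbol; for
  \<open>d = 1\<close> it is the number of admissible words of length \<open>n + 1\<close> with a given first symbol.
\<close>

primrec block_count ::
    "nat \<Rightarrow> 'a set \<Rightarrow> ('a \<Rightarrow> 'a \<Rightarrow> real) \<Rightarrow> nat \<Rightarrow> 'a \<Rightarrow> real" where
  "block_count d I a 0 = (\<lambda>_. 1)"
| "block_count d I a (Suc n) = (\<lambda>i. (\<Sum>j\<in>I. a i j * block_count d I a n j) ^ d)"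

lemma Jensen_ln:
  fixes p x :: "'a \<Rightarrow> real"
  assumes fin: "finite I" and p: "\<And>i. i \<in> I \<Longrightarrow> 0 \<le> p i" "(\<Sum>i\<in>I. p i) = 1"
    and x: "\<And>i. i \<in> I \<Longrightarrow> 0 < x i"
  defines "m \<equiv> \<Sum>i\<in>I. p i * x i"
  shows "(\<Sum>i\<in>I. p i * ln (x i)) \<le> ln m"
    and "(\<Sum>i\<in>I. p i * ln (x i)) = ln m \<Longrightarrow> i \<in> I \<Longrightarrow> 0 < p i \<Longrightarrow> x i = m"
proof -
  have "\<exists>i\<in>I. 0 < p i"
  proof (rule ccontr)
    assume "\<not> ?thesis"
    then have "(\<Sum>i\<in>I. p i) \<le> 0" by (intro sum_nonpos) force
    then show False using p by simp
  qed
  then have m: "0 < m"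
    
  proof -
    from \<open>\<exists>i\<in>I. 0 < p i\<close> obtain i where "i \<in> I" "0 < p i" by blast
    then show ?thesis unfolding m_def using p x fin
      by (intro sum_pos2[of I i]) (auto simp: less_imp_le)
  qed
  have gap: "0 \<le> p i * (x i / m - 1 - ln (x i / m))" if "i \<in> I" for i
    using that p x m by (intro mult_nonneg_nonneg) (auto simp: ln_le_minus_one)
  have "(\<Sum>i\<in>I. p i * (x i / m - 1 - ln (x i / m)))
      = (\<Sum>i\<in>I. p i * x i / m - p i - p i * ln (x i) + p i * ln m)"
  proof (rule sum.cong[OF refl])
    fix i assume "i \<in> I"
    then have ln_quot: "ln (x i / m) = ln (x i) - ln m" using x[of i] m by (simp add: ln_div)
    show "p i * (x i / m - 1 - ln (x i / m)) = p i * x i / m - p i - p i * ln (x i) + p i * ln m"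
      unfolding ln_quot by (simp add: algebra_simps)
  qed
  also have "\<dots> = m / m - 1 - (\<Sum>i\<in>I. p i * ln (x i)) + ln m"
    using p(2) by (simp only: sum.distrib sum_subtractf sum_divide_distrib[symmetric]
        sum_distrib_right[symmetric] m_def[symmetric] mult_1)
  finally have eq: "(\<Sum>i\<in>I. p i * (x i / m - 1 - ln (x i / m))) = ln m - (\<Sum>i\<in>I. p i * ln (x i))"
    using m by simp
  have "0 \<le> (\<Sum>i\<in>I. p i * (x i / m - 1 - ln (x i / m)))" using gap by (rule sum_nonneg)
  then show "(\<Sum>i\<in>I. p i * ln (x i)) \<le> ln m" using eq by simp
  assume "(\<Sum>i\<in>I. p i * ln (x i)) = ln m" and i: "i \<in> I" "0 < p i"
  then have "(\<Sum>i\<in>I. p i * (x i / m - 1 - ln (x i / m))) = 0" using eq by simp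
  then have "p i * (x i / m - 1 - ln (x i / m)) = 0"
    using sum_nonneg_eq_0_iff[of I "\<lambda>i. p i * (x i / m - 1 - ln (x i / m))"] fin gap i(1) by blast
  then have "ln (x i / m) = x i / m - 1" using i by simp
  then have "x i / m = 1" using x[OF i(1)] m by (intro ln_eq_minus_one) auto
  then show "x i = m" using m by simp
qed

context Perron_weights
begin

abbreviation total :: "nat \<Rightarrow> nat \<Rightarrow> real" where
  "total d n \<equiv> \<Sum>i\<in>I. block_count d I a n i"

lemma weighted_row_pos:
  assumes "\<And>j. j \<in> I \<Longrightarrow> 0 < x j" "i \<in> I"
  shows "0 < (\<Sum>j\<in>I. a i j * x j)"
proof -
  obtain j where "j \<in> I" "0 < a i j" using row assms by blast
  then show ?thesis
    using assms nonneg fin by (intro sum_pos2[of I j]) (auto simp: less_imp_le)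
qed

lemma block_count_pos: "i \<in> I \<Longrightarrow> 0 < block_count d I a n i"
  by (induction n arbitrary: i) (auto intro!: zero_less_power weighted_row_pos)

lemma block_count_le_total: "i \<in> I \<Longrightarrow> block_count d I a n i \<le> total d n"
  using fin by (intro member_le_sum) (auto intro: less_imp_le block_count_pos)

lemma total_pos: "0 < total d n"
  using fin ne by (intro sum_pos) (auto intro: block_count_pos)

lemma sum_left_action: "(\<Sum>i\<in>I. l i * (\<Sum>j\<in>I. a i j * x j)) = c * (\<Sum>j\<in>I. l j * x j)"
proof -
  have "(\<Sum>i\<in>I. l i * (\<Sum>j\<in>I. a i j * x j)) = (\<Sum>j\<in>I. c * l j * x j)"
    unfolding sum_bilinear_swap using left by (intro sum.cong) simp_all
  then show ?thesis by (simp only: sum_distrib_left mult.assoc)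
qed

lemma constant_row_sum:
  assumes "\<And>i. i \<in> I \<Longrightarrow> (\<Sum>j\<in>I. a i j) = s"
  shows "s = c"
proof -
  have "s * (\<Sum>i\<in>I. l i) = c * (\<Sum>i\<in>I. l i)"
    using sum_left_action[of "\<lambda>_. 1"] assms by (simp add: sum_distrib_left mult.commute)
  moreover have "0 < (\<Sum>i\<in>I. l i)" using fin ne l by (rule sum_pos)
  ultimately show ?thesis by simp
qed

lemma left_word_count: "(\<Sum>i\<in>I. l i * block_count 1 I a n i) = c ^ n * (\<Sum>i\<in>I. l i)"
  by (induction n) (simp_all add: sum_left_action)

text \<open>
  Pairing with the left eigenvector makes the word count exactly geometric
  (\<open>left_word_count\<close>), and the total differs from this pairing by bounded factors only.
\<close>

theorem word_growth: "(\<lambda>n. ln (total 1 n) / real (Suc n)) \<longlonglongrightarrow> ln c"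
proof -
  define L where "L = (\<Sum>i\<in>I. l i)"
  define K where "K = L * (\<Sum>i\<in>I. 1 / l i)"
  have L: "0 < L" unfolding L_def using fin ne l by (intro sum_pos) auto
  have K: "0 < K" unfolding K_def using L fin ne l by (intro mult_pos_pos sum_pos) auto
  have lower: "c ^ n \<le> total 1 n" for n
  proof -
    have "c ^ n * L \<le> (\<Sum>i\<in>I. L * block_count 1 I a n i)"
      unfolding L_def left_word_count[symmetric]
    proof (intro sum_mono mult_right_mono)
      show "l i \<le> (\<Sum>i\<in>I. l i)" if "i \<in> I" for i
        using that fin l by (intro member_le_sum) (auto intro: less_imp_le)
    qed (auto intro: less_imp_le block_count_pos)
    then show ?thesis using L by (simp add: sum_distrib_left[symmetric] mult.commute)
  qed
  have upper: "total 1 n \<le> c ^ n * K" for n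
  proof -
    have "block_count 1 I a n i \<le> c ^ n * L * (1 / l i)" if i: "i \<in> I" for i
    proof -
      have "l i * block_count 1 I a n i \<le> c ^ n * L"
        unfolding L_def left_word_count[symmetric] using fin l i
        by (intro member_le_sum) (simp_all add: less_imp_le block_count_pos)
      then show ?thesis using l[OF i] by (simp add: field_simps)
    qed
    then have "total 1 n \<le> (\<Sum>i\<in>I. c ^ n * L * (1 / l i))" by (intro sum_mono) auto
    then show ?thesis by (simp add: K_def sum_distrib_left mult_ac)
  qed
  show ?thesis
  proof (rule tendsto_sandwich[OF always_eventually always_eventually])
    show "\<forall>n. real n * ln c / real (Suc n) \<le> ln (total 1 n) / real (Suc n)"
    proof
      fix n
      have "real n * ln c = ln (c ^ n)" using c by (simp add: ln_realpow)
      also have "\<dots> \<le> ln (total 1 n)" using lower[of n] c total_pos by (intro ln_mono) auto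
      finally show "real n * ln c / real (Suc n) \<le> ln (total 1 n) / real (Suc n)"
        by (rule divide_right_mono) simp
    qed
    show "\<forall>n. ln (total 1 n) / real (Suc n) \<le> (real n * ln c + ln K) / real (Suc n)"
    proof
      fix n
      have "ln (total 1 n) \<le> ln (c ^ n * K)" using upper[of n] c K total_pos by (intro ln_mono) auto
      also have "\<dots> = real n * ln c + ln K" using c K by (simp add: ln_realpow ln_mult)
      finally show "ln (total 1 n) / real (Suc n) \<le> (real n * ln c + ln K) / real (Suc n)"
        by (rule divide_right_mono) simp
    qed
    show "(\<lambda>n. real n * ln c / real (Suc n)) \<longlonglongrightarrow> ln c"
      using tendsto_mult_right[OF LIMSEQ_n_over_Suc_n, of "ln c"] by (simp add: mult.commute)
    then have "(\<lambda>n. real n * ln c / real (Suc n) + ln K / real (Suc n)) \<longlonglongrightarrow> ln c + 0"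
      by (intro tendsto_add LIMSEQ_Suc[OF lim_const_over_n])
    then show "(\<lambda>n. (real n * ln c + ln K) / real (Suc n)) \<longlonglongrightarrow> ln c"
      by (simp add: add_divide_distrib)
  qed
qed

end

text \<open>
  The number of nonempty words of length at most \<open>n\<close> over \<open>d\<close> letters, that is \<open>|Delta_n| - 1\<close>.
\<close>

definition proper_size :: "nat \<Rightarrow> nat \<Rightarrow> real" where
  "proper_size d n = (\<Sum>j<n. real d ^ Suc j)"

lemma proper_size_0 [simp]: "proper_size d 0 = 0"
  by (simp add: proper_size_def)

lemma proper_size_Suc: "proper_size d (Suc n) = real d * (proper_size d n + 1)"
  by (simp only: proper_size_def sum.lessThan_Suc_shift)
    (simp add: sum_distrib_left algebra_simps)

lemma proper_size_nonneg: "0 \<le> proper_size d n"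
  by (auto simp: proper_size_def intro: sum_nonneg)

lemma proper_size_ge:
  assumes "d \<ge> 1"
  shows "real n \<le> proper_size d n"
proof (induction n)
  case (Suc n)
  then have "real n + 1 \<le> 1 * (proper_size d n + 1)" by simp
  also have "\<dots> \<le> real d * (proper_size d n + 1)"
    using assms proper_size_nonneg[of d n] by (intro mult_right_mono) auto
  finally show ?case by (simp add: proper_size_Suc)
qed simp

lemma proper_size_closed:
  assumes "d \<ge> 2"
  shows "proper_size d n = real d / (real d - 1) * (real d ^ n - 1)"
  using assms by (induction n) (auto simp: proper_size_Suc field_simps)

section \<open>Tree growth against the Perron eigenvalue\<close>

locale Perron_tree = Perron_weights +
  fixes d :: nat
  assumes d: "2 \<le> d"
begin

abbreviation N :: "nat \<Rightarrow> 'a \<Rightarrow> real" where "N \<equiv> block_count d I a"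
abbreviation D :: "nat \<Rightarrow> real" where "D \<equiv> proper_size d"

text \<open>The logarithmic deviation of the block count from growth at the exact rate \<open>c\<close>.\<close>

definition u :: "nat \<Rightarrow> 'a \<Rightarrow> real" where "u n i = ln (N n i) - D n * ln c"

text \<open>
  \<open>l i * r i\<close> is, up to normalisation, the stationary distribution of the Parry measure of the
  Markov shift.
\<close>

definition U :: "nat \<Rightarrow> real" where "U n = (\<Sum>i\<in>I. l i * r i * u n i)"

lemma u_0 [simp]: "u 0 i = 0"
  by (simp add: u_def)

lemma u_Suc:
  assumes "i \<in> I"
  shows "u (Suc n) i = real d * (ln (\<Sum>j\<in>I. a i j * N n j) - ln c - D n * ln c)"
proof -
  have "0 < (\<Sum>j\<in>I. a i j * N n j)" using assms by (intro weighted_row_pos block_count_pos)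
  then show ?thesis by (simp add: u_def ln_realpow proper_size_Suc algebra_simps)
qed

text \<open>
  Jensen's inequality is applied in each row to the transition probabilities \<open>P i j\<close> of the Parry
  measure and the values \<open>N n j / r j\<close>. Stationarity of \<open>l i * r i\<close> makes the
  average of the right-hand sides collapse to the average at level \<open>n\<close>, and the corrections by
  \<open>ln r\<close> cancel. Equality forces \<open>N n j / r j\<close> to be the same for all successors \<open>j\<close> of \<open>i\<close>.
\<close>

lemma U_Suc:
  shows U_Suc_ge: "real d * U n \<le> U (Suc n)"
    and U_Suc_eq: "U (Suc n) = real d * U n \<Longrightarrow> i \<in> I \<Longrightarrow> j \<in> I \<Longrightarrow> 0 < a i j \<Longrightarrow>
      u (Suc n) i = real d * (u n j + ln (r i) - ln (r j))"
proof -
  define S where "S i = (\<Sum>j\<in>I. a i j * N n j)" for i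
  define P where "P i j = a i j * r j / (c * r i)" for i j
  define x where "x j = N n j / r j" for j
  define J where "J i = ln (S i / (c * r i)) - (\<Sum>j\<in>I. P i j * ln (x j))" for i
  have S: "0 < S i" if "i \<in> I" for i
    unfolding S_def using that by (intro weighted_row_pos block_count_pos)
  have x: "0 < x j" if "j \<in> I" for j using that r by (simp add: x_def block_count_pos)
  have P0: "0 \<le> P i j" if "i \<in> I" "j \<in> I" for i j
    using that r[of i] r[of j] c nonneg by (simp add: P_def)
  have P1: "(\<Sum>j\<in>I. P i j) = 1" if i: "i \<in> I" for i
    using right[OF i] c r[OF i] by (simp add: P_def sum_divide_distrib[symmetric])
  have Px: "(\<Sum>j\<in>I. P i j * x j) = S i / (c * r i)" for i
  proof -
    have "P i j * x j = a i j * N n j / (c * r i)" if "j \<in> I" for j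
      using r[OF that] by (simp add: P_def x_def)
    then show ?thesis by (simp add: S_def sum_divide_distrib)
  qed
  have J0: "0 \<le> J i" if i: "i \<in> I" for i
    using Jensen_ln(1)[of I "P i" x] fin P0[OF i] P1[OF i] x by (simp add: J_def Px)
  have lP: "l i * r i * P i j = l i * a i j * (r j / c)" if "i \<in> I" for i j
    using r[OF that] c by (simp add: P_def)
  have "(\<Sum>i\<in>I. l i * r i * (\<Sum>j\<in>I. P i j * ln (x j)))
      = (\<Sum>i\<in>I. \<Sum>j\<in>I. (l i * r i * P i j) * ln (x j))"
    by (simp only: sum_distrib_left mult.assoc)
  also have "\<dots> = (\<Sum>i\<in>I. \<Sum>j\<in>I. l i * a i j * (r j / c) * ln (x j))"
    by (intro sum.cong refl) (simp only: lP)
  also have "\<dots> = (\<Sum>i\<in>I. l i * (\<Sum>j\<in>I. a i j * (r j / c * ln (x j))))"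
    by (simp only: sum_distrib_left mult.assoc)
  also have "\<dots> = (\<Sum>j\<in>I. l j * r j * ln (x j))"
    unfolding sum_left_action using c by (simp add: sum_distrib_left mult.assoc)
  finally have "(\<Sum>i\<in>I. l i * r i * J i) = (\<Sum>i\<in>I. l i * r i * (ln (S i / (c * r i)) - ln (x i)))"
    by (simp add: J_def right_diff_distrib sum_subtractf)
  also have "real d * \<dots> = (\<Sum>i\<in>I. l i * r i * (u (Suc n) i - real d * u n i))"
    unfolding sum_distrib_left
  proof (rule sum.cong[OF refl])
    fix i assume i: "i \<in> I"
    have ln_diff: "ln (S i / (c * r i)) - ln (x i) = ln (S i) - ln c - ln (N n i)"
      using S[OF i] c r[OF i] block_count_pos[OF i, of d n] by (simp add: x_def ln_div ln_mult)
    have "real d * (ln (S i / (c * r i)) - ln (x i)) = u (Suc n) i - real d * u n i"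
      unfolding ln_diff by (simp add: u_Suc[OF i] S_def[symmetric] u_def[of n] algebra_simps)
    then show "real d * (l i * r i * (ln (S i / (c * r i)) - ln (x i))) =
        l i * r i * (u (Suc n) i - real d * u n i)" by (simp add: mult_ac)
  qed
  also have "\<dots> = U (Suc n) - real d * U n"
    by (simp add: U_def right_diff_distrib sum_subtractf sum_distrib_left mult_ac)
  finally have gap: "real d * (\<Sum>i\<in>I. l i * r i * J i) = U (Suc n) - real d * U n" .
  have summand: "0 \<le> l i * r i * J i" if "i \<in> I" for i
    using that J0 l r by (intro mult_nonneg_nonneg) (auto intro: less_imp_le)
  then have "0 \<le> real d * (\<Sum>i\<in>I. l i * r i * J i)"
    by (intro mult_nonneg_nonneg[OF of_nat_0_le_iff] sum_nonneg)
  then show "real d * U n \<le> U (Suc n)" using gap by simp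
  assume "U (Suc n) = real d * U n" and i: "i \<in> I" and j: "j \<in> I" "0 < a i j"
  then have "(\<Sum>i\<in>I. l i * r i * J i) = 0" using gap d by simp
  then have "l i * r i * J i = 0" using sum_nonneg_eq_0_iff[OF fin, of "\<lambda>i. l i * r i * J i"] summand i by simp
  then have "J i = 0" using l[OF i] r[OF i] by simp
  moreover have "0 < P i j" using j r[OF i] r[OF j(1)] c by (simp add: P_def)
  ultimately have "x j = S i / (c * r i)"
    using Jensen_ln(2)[of I "P i" x j] fin P0[OF i] P1[OF i] x j(1) by (simp add: J_def Px)
  then have "ln (x j) = ln (S i / (c * r i))" by simp
  then have ln_S: "ln (S i) = ln (N n j) - ln (r j) + ln c + ln (r i)"
    using S[OF i] c r[OF i] r[OF j(1)] block_count_pos[OF j(1), of d n]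
    by (simp add: x_def ln_div ln_mult)
  show "u (Suc n) i = real d * (u n j + ln (r i) - ln (r j))"
    unfolding u_Suc[OF i] S_def[symmetric] ln_S u_def[of n] by (simp add: algebra_simps)
qed

lemma U_nonneg: "0 \<le> U n"
proof (induction n)
  case 0 then show ?case by (simp add: U_def)
next
  case (Suc n)
  then show ?case using U_Suc_ge[of n] d by (smt (verit) mult_nonneg_nonneg of_nat_0_le_iff)
qed

text \<open>
  The same deviation for the number of all \<open>n\<close>-blocks; the tree grows at rate \<open>c\<close> precisely when
  it is \<open>o(d ^ n)\<close>.
\<close>

definition excess :: "nat \<Rightarrow> real" where "excess n = ln (total d n) - D n * ln c"

lemma u_le_excess: "i \<in> I \<Longrightarrow> u n i \<le> excess n"
  using block_count_le_total block_count_pos total_pos by (simp add: u_def excess_def)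

lemma U_le_excess: "U n \<le> (\<Sum>i\<in>I. l i * r i) * excess n"
  unfolding U_def sum_distrib_right
  using l r u_le_excess by (intro sum_mono mult_left_mono) (auto intro: less_imp_le)

lemma weight_pos: "0 < (\<Sum>i\<in>I. l i * r i)"
  using fin ne l r by (intro sum_pos) auto

lemma excess_nonneg: "0 \<le> excess n"
proof -
  have "0 \<le> (\<Sum>i\<in>I. l i * r i) * excess n" using U_nonneg U_le_excess by (rule order_trans)
  then show ?thesis using weight_pos by (simp add: zero_le_mult_iff)
qed

text \<open>
  Each \<open>u n j\<close> is at most the excess while their weighted average is nonnegative, so none of them
  can be very negative either.
\<close>

lemma abs_u_le_excess:
  assumes i: "i \<in> I"
  shows "\<bar>u n i\<bar> \<le> (1 + (\<Sum>j\<in>I. l j * r j) / (l i * r i)) * excess n"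
proof -
  define Z where "Z = (\<Sum>j\<in>I. l j * r j)"
  have w: "0 < l i * r i" using l r i by simp
  have "0 \<le> l i * r i * u n i + (\<Sum>j\<in>I - {i}. l j * r j * u n j)"
    using U_nonneg[of n] fin i by (simp add: U_def sum.remove)
  also have "(\<Sum>j\<in>I - {i}. l j * r j * u n j) \<le> (\<Sum>j\<in>I - {i}. l j * r j * excess n)"
    using l r u_le_excess by (intro sum_mono mult_left_mono) (auto intro: less_imp_le)
  also have "\<dots> \<le> (\<Sum>j\<in>I. l j * r j * excess n)"
    using l r fin excess_nonneg
    by (intro sum_mono2) (auto intro!: mult_nonneg_nonneg intro: less_imp_le)
  also have "\<dots> = Z * excess n" by (simp add: Z_def sum_distrib_right)
  finally have "- u n i * (l i * r i) \<le> Z * excess n" by (simp add: mult_ac)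
  then have "- u n i \<le> Z / (l i * r i) * excess n" using w by (simp add: pos_le_divide_eq)
  moreover have "u n i \<le> excess n" using i by (rule u_le_excess)
  moreover have "0 \<le> Z / (l i * r i) * excess n"
    using w weight_pos excess_nonneg[of n] by (simp add: Z_def)
  ultimately show ?thesis using excess_nonneg[of n]
    unfolding Z_def[symmetric] by (simp add: algebra_simps)
qed

text \<open>
  \<open>U n / d ^ n\<close> starts at 0, increases and tends to 0, hence vanishes identically, and the equality
  case of Jensen's inequality holds at every level. The increments of \<open>u\<close> then gain a factor of
  exactly \<open>d\<close> at each step backwards along an edge, which is compatible with \<open>u n = o(d ^ n)\<close>
  only if the first increment is 0.
\<close>

lemma vanishing_excess_imp_row_sums:
  assumes lim0: "(\<lambda>n. excess n / real d ^ n) \<longlonglongrightarrow> 0" and i: "i \<in> I"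
  shows "(\<Sum>j\<in>I. a i j) = c"
proof -
  have dpos: "0 < real d ^ n" for n using d by simp
  have "incseq (\<lambda>n. U n / real d ^ n)"
    using U_Suc_ge d by (intro incseq_SucI) (simp add: field_simps)
  moreover have "(\<lambda>n. U n / real d ^ n) \<longlonglongrightarrow> 0"
  proof (rule tendsto_sandwich[OF always_eventually always_eventually])
    show "\<forall>n. 0 \<le> U n / real d ^ n" using U_nonneg by simp
    show "\<forall>n. U n / real d ^ n \<le> (\<Sum>i\<in>I. l i * r i) * (excess n / real d ^ n)"
      using U_le_excess by (simp add: divide_right_mono)
    show "(\<lambda>n. (\<Sum>i\<in>I. l i * r i) * (excess n / real d ^ n)) \<longlonglongrightarrow> 0"
      using tendsto_mult_right_zero[OF lim0] .
  qed simp
  ultimately have "U n / real d ^ n \<le> 0" for n by (rule incseq_le)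
  then have "U n \<le> 0" for n using dpos[of n] by (meson divide_pos_pos not_le)
  then have U0: "U n = 0" for n using U_nonneg[of n] by (simp add: order_antisym)
  have step: "u (Suc n) i = real d * (u n j + ln (r i) - ln (r j))"
    if "i \<in> I" "j \<in> I" "0 < a i j" for i j n
    by (rule U_Suc_eq) (use U0 that in auto)
  define t where "t n i = u (Suc n) i - u n i" for n i
  have t_Suc: "t (Suc n) i = real d * t n j" if "i \<in> I" "j \<in> I" "0 < a i j" for i j n
    unfolding t_def step[OF that] by (simp add: algebra_simps)
  \<comment> \<open>Every symbol has a predecessor, so the initial increment at \<open>i\<close> is carried to all levels.\<close>
  have reach: "\<exists>i'\<in>I. t n i' = real d ^ n * t 0 i" for n
  proof (induction n)
    case 0 then show ?case using i by auto
  next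
    case (Suc n)
    then obtain j where j: "j \<in> I" "t n j = real d ^ n * t 0 i" by blast
    obtain i' where "i' \<in> I" "0 < a i' j" using col j by blast
    then show ?case using t_Suc[of i' j n] j by (intro bexI[of _ i']) auto
  qed
  have u_lim: "(\<lambda>n. u n j / real d ^ n) \<longlonglongrightarrow> 0" if j: "j \<in> I" for j
  proof (rule tendsto_0_le[OF lim0 always_eventually])
    show "\<forall>n. norm (u n j / real d ^ n)
        \<le> norm (excess n / real d ^ n) * (1 + (\<Sum>m\<in>I. l m * r m) / (l j * r j))"
      using abs_u_le_excess[OF j] excess_nonneg by (simp add: divide_right_mono mult.commute)
  qed
  have "(\<lambda>n. t n j / real d ^ n) \<longlonglongrightarrow> 0" if j: "j \<in> I" for j
  proof -
    have "(\<lambda>n. real d * (u (Suc n) j / real d ^ Suc n) - u n j / real d ^ n) \<longlonglongrightarrow> real d * 0 - 0"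
      using u_lim[OF j] LIMSEQ_Suc[OF u_lim[OF j]] by (intro tendsto_intros)
    moreover have "real d * (u (Suc n) j / real d ^ Suc n) - u n j / real d ^ n = t n j / real d ^ n" for n
      using d by (simp add: t_def diff_divide_distrib)
    ultimately show ?thesis by simp
  qed
  then have "(\<lambda>n. \<Sum>j\<in>I. \<bar>t n j / real d ^ n\<bar>) \<longlonglongrightarrow> (\<Sum>j\<in>I. \<bar>0\<bar>)"
    by (intro tendsto_sum tendsto_rabs)
  moreover have "\<bar>t 0 i\<bar> \<le> (\<Sum>j\<in>I. \<bar>t n j / real d ^ n\<bar>)" for n
  proof -
    obtain j where j: "j \<in> I" "t n j = real d ^ n * t 0 i" using reach by blast
    then have "\<bar>t 0 i\<bar> = \<bar>t n j / real d ^ n\<bar>" using d by simp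
    also have "\<dots> \<le> (\<Sum>j\<in>I. \<bar>t n j / real d ^ n\<bar>)"
      using j(1) fin by (intro member_le_sum) auto
    finally show ?thesis .
  qed
  ultimately have "\<bar>t 0 i\<bar> \<le> (\<Sum>j\<in>I. \<bar>0\<bar>)" by (intro LIMSEQ_le_const) auto
  then have "ln (\<Sum>j\<in>I. a i j) = ln c" using d by (simp add: t_def u_Suc[OF i])
  moreover have "0 < (\<Sum>j\<in>I. a i j)" using weighted_row_pos[of "\<lambda>_. 1" i] i by simp
  ultimately show ?thesis using c by simp
qed

lemma size_ratio: "(\<lambda>n. (D n + 1) / real d ^ n) \<longlonglongrightarrow> real d / (real d - 1)"
proof -
  have d1: "1 < real d" using d by simp
  have eq: "(D n + 1) / real d ^ n = real d / (real d - 1) - 1 / (real d - 1) * (1 / real d) ^ n" for n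
  proof -
    have "(D n + 1) / real d ^ n = (real d - 1 / real d ^ n) / (real d - 1)"
      using d1 by (simp add: proper_size_closed[OF d] field_simps)
    then show ?thesis by (simp add: diff_divide_distrib power_one_over)
  qed
  have "(\<lambda>n. real d / (real d - 1) - 1 / (real d - 1) * (1 / real d) ^ n)
      \<longlonglongrightarrow> real d / (real d - 1) - 1 / (real d - 1) * 0"
    using d1 by (intro tendsto_intros LIMSEQ_realpow_zero) auto
  then show ?thesis unfolding eq by simp
qed

lemma total_Suc_le: "\<exists>K. \<forall>n. ln (total d (Suc n)) \<le> real d * ln (total d n) + K"
proof -
  define B where "B = (\<Sum>i\<in>I. \<Sum>j\<in>I. a i j)"
  define C where "C = real (card I) * B ^ d"
  have rows: "0 < (\<Sum>j\<in>I. a i j)" if "i \<in> I" for i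
    using weighted_row_pos[of "\<lambda>_. 1" i] that by simp
  have B: "0 < B" unfolding B_def by (rule sum_pos[OF fin ne rows])
  have C: "0 < C" using B fin ne by (simp add: C_def card_gt_0_iff)
  have "ln (total d (Suc n)) \<le> real d * ln (total d n) + ln C" for n
  proof -
    have row_le: "(\<Sum>j\<in>I. a i j * N n j) \<le> B * total d n" if i: "i \<in> I" for i
    proof -
      have "(\<Sum>j\<in>I. a i j * N n j) \<le> (\<Sum>j\<in>I. a i j * total d n)"
        using i nonneg block_count_le_total by (intro sum_mono mult_left_mono) auto
      also have "\<dots> = (\<Sum>j\<in>I. a i j) * total d n" by (simp add: sum_distrib_right)
      also have "\<dots> \<le> B * total d n" unfolding B_def using i fin rows total_pos[of d n]
        by (intro mult_right_mono member_le_sum) (auto intro: less_imp_le)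
      finally show ?thesis .
    qed
    have "total d (Suc n) \<le> (\<Sum>i\<in>I. (B * total d n) ^ d)"
      unfolding block_count.simps
      by (intro sum_mono power_mono row_le less_imp_le[OF weighted_row_pos] block_count_pos)
    also have "\<dots> = C * total d n ^ d" by (simp add: C_def power_mult_distrib)
    finally have "ln (total d (Suc n)) \<le> ln (C * total d n ^ d)"
      using total_pos[of d "Suc n"] by (intro ln_mono) auto
    also have "\<dots> = real d * ln (total d n) + ln C"
      using C total_pos[of d n] by (simp add: ln_mult ln_realpow)
    finally show ?thesis .
  qed
  then show ?thesis by blast
qed

text \<open>
  By one step of the recursion, \<open>total d (n + 1)\<close> is at most a constant times \<open>total d n ^ d\<close>. So
  \<open>ln (total d n) / d ^ n\<close> is decreasing after adding a suitable multiple of \<open>1 / d ^ n\<close>, and it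
  is bounded below because the excess is nonnegative.
\<close>

lemma tree_growth_exists: "convergent (\<lambda>n. ln (total d n) / (D n + 1))"
proof -
  obtain K where K: "\<And>n. ln (total d (Suc n)) \<le> real d * ln (total d n) + K"
    using total_Suc_le by blast
  have d1: "1 < real d" using d by simp
  \<comment> \<open>The shift by \<open>\<bar>K\<bar>\<close> suffices for monotonicity because \<open>\<bar>K\<bar> + \<bar>K\<bar> \<le> d * \<bar>K\<bar>\<close>.\<close>
  define Y where "Y n = (ln (total d n) + \<bar>K\<bar>) / real d ^ n" for n
  have "decseq Y"
  proof (rule decseq_SucI)
    fix n
    have "ln (total d (Suc n)) + \<bar>K\<bar> \<le> real d * ln (total d n) + 2 * \<bar>K\<bar>" using K[of n] by simp
    also have "\<dots> \<le> real d * (ln (total d n) + \<bar>K\<bar>)"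
      using d mult_right_mono[of 2 "real d" "\<bar>K\<bar>"] by (simp add: algebra_simps)
    finally have "Y (Suc n) \<le> real d * (ln (total d n) + \<bar>K\<bar>) / real d ^ Suc n"
      unfolding Y_def using d1 by (intro divide_right_mono) auto
    then show "Y (Suc n) \<le> Y n" using d1 by (simp add: Y_def)
  qed
  moreover have "- (real d / (real d - 1) * \<bar>ln c\<bar>) \<le> Y n" for n
  proof -
    have Dle: "D n \<le> real d / (real d - 1) * real d ^ n"
      unfolding proper_size_closed[OF d] using d1 by (intro mult_left_mono) auto
    have "- (real d / (real d - 1) * \<bar>ln c\<bar>) * real d ^ n \<le> - (D n * \<bar>ln c\<bar>)"
      using mult_right_mono[OF Dle, of "\<bar>ln c\<bar>"] by (simp add: mult_ac)
    also have "\<dots> \<le> D n * ln c"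
      using mult_left_mono[OF _ proper_size_nonneg, of "- \<bar>ln c\<bar>" "ln c" d n] by simp
    also have "\<dots> \<le> ln (total d n) + \<bar>K\<bar>" using excess_nonneg[of n] by (simp add: excess_def)
    finally show ?thesis unfolding Y_def using d1 by (subst pos_le_divide_eq) auto
  qed
  ultimately obtain L where L: "Y \<longlonglongrightarrow> L" using decseq_convergent by blast
  have "(\<lambda>n. (Y n - \<bar>K\<bar> * (1 / real d) ^ n) / ((D n + 1) / real d ^ n))
      \<longlonglongrightarrow> (L - \<bar>K\<bar> * 0) / (real d / (real d - 1))"
    using d1 by (intro tendsto_intros L size_ratio LIMSEQ_realpow_zero) auto
  moreover have "(Y n - \<bar>K\<bar> * (1 / real d) ^ n) / ((D n + 1) / real d ^ n)
      = ln (total d n) / (D n + 1)" for n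
  proof -
    have "Y n - \<bar>K\<bar> * (1 / real d) ^ n = ln (total d n) / real d ^ n"
      by (simp add: Y_def power_one_over add_divide_distrib)
    then show ?thesis using d1 by simp
  qed
  ultimately have "(\<lambda>n. ln (total d n) / (D n + 1))
      \<longlonglongrightarrow> (L - \<bar>K\<bar> * 0) / (real d / (real d - 1))" by (simp only:)
  then show ?thesis by (rule convergentI)
qed

theorem tree_growth_eq_iff:
  "(\<lambda>n. ln (total d n) / (D n + 1)) \<longlonglongrightarrow> ln c \<longleftrightarrow> (\<forall>i\<in>I. (\<Sum>j\<in>I. a i j) = c)"
proof
  assume lim: "(\<lambda>n. ln (total d n) / (D n + 1)) \<longlonglongrightarrow> ln c"
  have d1: "1 < real d" using d by simp
  have "(\<lambda>n. (ln (total d n) / (D n + 1) - ln c) * ((D n + 1) / real d ^ n) + ln c * (1 / real d) ^ n)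
     \<longlonglongrightarrow> (ln c - ln c) * (real d / (real d - 1)) + ln c * 0"
    using d1 by (intro tendsto_intros lim size_ratio LIMSEQ_realpow_zero) auto
  moreover have "(ln (total d n) / (D n + 1) - ln c) * ((D n + 1) / real d ^ n) + ln c * (1 / real d) ^ n
     = excess n / real d ^ n" for n
  proof -
    have "0 < D n + 1" using proper_size_nonneg[of d n] by simp
    then have "(ln (total d n) / (D n + 1) - ln c) * (D n + 1) = ln (total d n) - ln c * (D n + 1)"
      by (simp add: left_diff_distrib)
    then have "(ln (total d n) / (D n + 1) - ln c) * ((D n + 1) / real d ^ n)
        = (ln (total d n) - ln c * (D n + 1)) / real d ^ n"
      by (metis times_divide_eq_right)
    also have "\<dots> + ln c * (1 / real d) ^ n = excess n / real d ^ n"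
      by (simp add: excess_def power_one_over add_divide_distrib[symmetric] algebra_simps)
    finally show ?thesis .
  qed
  ultimately have "(\<lambda>n. excess n / real d ^ n) \<longlonglongrightarrow> 0" by simp
  then show "\<forall>i\<in>I. (\<Sum>j\<in>I. a i j) = c" using vanishing_excess_imp_row_sums by blast
next
  assume rows: "\<forall>i\<in>I. (\<Sum>j\<in>I. a i j) = c"
  have N: "N n i = exp (D n * ln c)" if "i \<in> I" for n i
    using that
  proof (induction n arbitrary: i)
    case (Suc n)
    then have "N (Suc n) i = (c * exp (D n * ln c)) ^ d"
      using rows by (simp add: sum_distrib_right[symmetric])
    also have "c * exp (D n * ln c) = exp ((D n + 1) * ln c)"
      using c by (simp add: distrib_right exp_add)
    finally show ?case by (simp add: proper_size_Suc exp_of_nat_mult[symmetric] mult_ac)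
  qed simp
  have "ln (total d n) = ln (real (card I)) + D n * ln c" for n
    using fin ne by (simp add: N ln_mult card_gt_0_iff)
  then have eq: "ln (total d n) / (D n + 1) = ln c + (ln (real (card I)) - ln c) / (D n + 1)" for n
    using proper_size_nonneg[of d n] by (simp add: field_simps)
  have "real n \<le> D n + 1" for n
    using proper_size_ge[of d n] d by simp
  then have "filterlim (\<lambda>n. D n + 1) at_top sequentially"
    by (intro filterlim_at_top_mono[OF filterlim_real_sequentially] always_eventually) auto
  then have "(\<lambda>n. (ln (real (card I)) - ln c) / (D n + 1)) \<longlonglongrightarrow> 0"
    by (intro real_tendsto_divide_at_top[OF tendsto_const])
  then show "(\<lambda>n. ln (total d n) / (D n + 1)) \<longlonglongrightarrow> ln c"
    unfolding eq using tendsto_add[OF tendsto_const, of _ 0 sequentially "ln c"] by simp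
qed

end

section \<open>Counting blocks of the tree-shift\<close>

lemma Nil_in_Delta [simp]: "[] \<in> Delta d n"
  by (simp add: Delta_def)

lemma Cons_in_Delta [simp]: "c # w \<in> Delta d (Suc n) \<longleftrightarrow> c < d \<and> w \<in> Delta d n"
  by (auto simp: Delta_def)

lemma snoc_in_Delta: "w \<in> tree_words d \<Longrightarrow> length w < n \<Longrightarrow> c < d \<Longrightarrow> w @ [c] \<in> Delta d n"
  by (auto simp: Delta_def)

lemma Delta_eq: "Delta d n = {w. set w \<subseteq> {..<d} \<and> length w \<le> n}"
  by (auto simp: Delta_def lists_eq_set)

lemma finite_Delta: "finite (Delta d n)"
  unfolding Delta_eq by (rule finite_lists_length_le) simp

lemma card_Delta: "real (card (Delta d n)) = proper_size d n + 1"
proof -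
  have "card (Delta d n) = (\<Sum>i\<le>n. d ^ i)"
    unfolding Delta_eq by (subst card_lists_length_le) simp_all
  then show ?thesis by (simp add: proper_size_def sum.atMost_shift)
qed

text \<open>
  These blocks are required to be consistent only within \<open>Delta d n\<close>; that each of them extends to
  a whole labeled tree is proved in \<open>tree_blocks_eq\<close>.
\<close>

definition rooted_blocks ::
    "nat \<Rightarrow> 'a set \<Rightarrow> ('a \<Rightarrow> 'a \<Rightarrow> bool) \<Rightarrow> nat \<Rightarrow> 'a \<Rightarrow> (nat list \<Rightarrow> 'a) set" where
  "rooted_blocks d I R n i = {u \<in> Delta d n \<rightarrow>\<^sub>E I. u [] = i \<and>
     (\<forall>w\<in>tree_words d. length w < n \<longrightarrow> (\<forall>c<d. R (u w) (u (w @ [c]))))}"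

lemma rooted_blocks_root: "u \<in> rooted_blocks d I R n i \<Longrightarrow> u [] = i"
  by (simp add: rooted_blocks_def)

lemma finite_rooted_blocks: "finite I \<Longrightarrow> finite (rooted_blocks d I R n i)"
  by (rule finite_subset[of _ "Delta d n \<rightarrow>\<^sub>E I"])
    (auto simp: rooted_blocks_def intro: finite_PiE finite_Delta)

text \<open>
  Cutting a block at its root leaves one block of smaller height for each child. The root symbol
  constrains each of these through its root only, so they can be chosen freely and independently.
\<close>

lemma rooted_blocks_branches:
  fixes d n :: nat and I :: "'a set"
  assumes i: "i \<in> I"
  defines "branches \<equiv> \<lambda>u. \<lambda>c\<in>{..<d}. \<lambda>w\<in>Delta d n. u (c # w)"
  shows "bij_betw branches (rooted_blocks d I R (Suc n) i)
    (\<Pi>\<^sub>E c\<in>{..<d}. \<Union>j\<in>{j\<in>I. R i j}. rooted_blocks d I R n j)"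
proof -
  define graft where
    "graft v = (\<lambda>w\<in>Delta d (Suc n). case w of [] \<Rightarrow> i | c # w' \<Rightarrow> v c w')" for v
  let ?B = "rooted_blocks d I R (Suc n) i"
  let ?P = "\<Pi>\<^sub>E c\<in>{..<d}. \<Union>j\<in>{j\<in>I. R i j}. rooted_blocks d I R n j"
  show ?thesis
  proof (rule bij_betwI)
    show "branches \<in> ?B \<rightarrow> ?P"
    proof (intro funcsetI PiE_I)
      fix u c assume u: "u \<in> ?B" and c: "c \<in> {..<d}"
      have edge: "R (u w) (u (w @ [e]))"
        if "w \<in> tree_words d" "length w < Suc n" "e < d" for w e
        using u that by (auto simp: rooted_blocks_def)
      have mem: "u w \<in> I" if "w \<in> Delta d (Suc n)" for w
        using u that by (auto simp: rooted_blocks_def)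
      have "branches u c \<in> rooted_blocks d I R n (u [c])"
        unfolding rooted_blocks_def
      proof (intro CollectI conjI ballI allI impI)
        show "branches u c \<in> Delta d n \<rightarrow>\<^sub>E I"
          using c mem by (auto simp: branches_def)
        show "branches u c [] = u [c]" using c by (simp add: branches_def)
        show "R (branches u c w) (branches u c (w @ [e]))"
          if "w \<in> tree_words d" "length w < n" "e < d" for w e
          using edge[of "c # w" e] that c snoc_in_Delta[OF that]
          by (simp add: branches_def Delta_def)
      qed
      moreover have "u [c] \<in> I" using c by (intro mem) simp
      moreover have "R i (u [c])" using edge[of "[]" c] u c by (simp add: rooted_blocks_def)
      ultimately show "branches u c \<in> (\<Union>j\<in>{j\<in>I. R i j}. rooted_blocks d I R n j)" by blast
    qed (simp add: branches_def)
    show "graft \<in> ?P \<rightarrow> ?B"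
    proof (intro funcsetI)
      fix v assume v: "v \<in> ?P"
      have v_edge: "R (v c w) (v c (w @ [e]))"
        if "c < d" "w \<in> tree_words d" "length w < n" "e < d" for c w e
        using PiE_mem[OF v, of c] that by (auto simp: rooted_blocks_def)
      have v_root: "R i (v c [])" if "c < d" for c
        using PiE_mem[OF v, of c] that by (auto simp: rooted_blocks_def)
      have v_mem: "v c w \<in> I" if "c < d" "w \<in> Delta d n" for c w
        using PiE_mem[OF v, of c] that by (auto simp: rooted_blocks_def)
      show "graft v \<in> ?B"
        unfolding rooted_blocks_def
      proof (intro CollectI conjI ballI allI impI)
        show "graft v \<in> Delta d (Suc n) \<rightarrow>\<^sub>E I"
          using i v_mem by (auto simp: graft_def split: list.splits)
        show "graft v [] = i" by (simp add: graft_def)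
        show "R (graft v w) (graft v (w @ [e]))"
          if w: "w \<in> tree_words d" "length w < Suc n" "e < d" for w e
        proof (cases w)
          case Nil
          then show ?thesis using w v_root by (simp add: graft_def)
        next
          case (Cons c w')
          then show ?thesis
            using w v_edge[of c w' e] snoc_in_Delta[of w' d n e]
            by (simp add: graft_def Delta_def)
        qed
      qed
    qed
    show "graft (branches u) = u" if "u \<in> ?B" for u
    proof (rule ext)
      fix w show "graft (branches u) w = u w"
      proof (cases "w \<in> Delta d (Suc n)")
        case True
        then show ?thesis
          using that by (cases w) (auto simp: graft_def branches_def rooted_blocks_def)
      next
        case False
        have "u \<in> Delta d (Suc n) \<rightarrow>\<^sub>E I" using that by (simp add: rooted_blocks_def)
        from PiE_arb[OF this False] show ?thesis using False by (simp add: graft_def)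
      qed
    qed
    show "branches (graft v) = v" if "v \<in> ?P" for v
    proof (rule ext)
      fix c show "branches (graft v) c = v c"
      proof (cases "c < d")
        case True
        then have vc: "v c \<in> Delta d n \<rightarrow>\<^sub>E I"
          using PiE_mem[OF that, of c] by (auto simp: rooted_blocks_def)
        have "branches (graft v) c w = v c w" for w
          using True PiE_arb[OF vc, of w]
          by (cases "w \<in> Delta d n") (simp_all add: branches_def graft_def)
        then show ?thesis by (rule ext)
      next
        case False
        then show ?thesis using PiE_arb[OF that, of c] by (simp add: branches_def)
      qed
    qed
  qed
qed

lemma card_rooted_blocks:
  assumes fin: "finite I"
  shows "i \<in> I \<Longrightarrow> real (card (rooted_blocks d I R n i)) = block_count d I (\<lambda>i j. of_bool (R i j)) n i"
proof (induction n arbitrary: i)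
  case 0
  have "rooted_blocks d I R 0 i = {\<lambda>w\<in>{[]}. i}"
    using 0 by (auto simp: rooted_blocks_def Delta_def fun_eq_iff PiE_def extensional_def)
  then show ?case by simp
next
  case (Suc n)
  let ?S = "{j\<in>I. R i j}"
  have disj: "card (\<Union>j\<in>?S. rooted_blocks d I R n j) = (\<Sum>j\<in>?S. card (rooted_blocks d I R n j))"
    using fin by (intro card_UN_disjoint) (auto intro: finite_rooted_blocks dest: rooted_blocks_root)
  have "card (rooted_blocks d I R (Suc n) i) = (\<Sum>j\<in>?S. card (rooted_blocks d I R n j)) ^ d"
    using bij_betw_same_card[OF rooted_blocks_branches[OF Suc.prems, of d n R]]
    by (simp add: card_PiE disj)
  moreover have "(\<Sum>j\<in>?S. real (card (rooted_blocks d I R n j)))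
      = (\<Sum>j\<in>I. of_bool (R i j) * block_count d I (\<lambda>i j. of_bool (R i j)) n j)"
    using fin Suc.IH by (intro sum.mono_neutral_cong_left) auto
  ultimately show ?case by simp
qed

text \<open>
  Every symbol has a successor, so a consistent block extends below its leaves by iterating a
  fixed successor function \<open>f\<close>. Conversely a block seen at some position of a tree is consistent.
\<close>

lemma tree_blocks_eq:
  assumes succ: "\<forall>i<dim_row A. \<exists>j<dim_row A. A $$ (i, j) = 1"
  defines "R \<equiv> \<lambda>i j. A $$ (i, j) = 1"
  shows "tree_blocks d n (hom_markov_tree_shift d A)
    = (\<Union>i<dim_row A. rooted_blocks d {..<dim_row A} R n i)"
    (is "?L = ?U")
proof
  show "?L \<subseteq> ?U"
  proof
    fix u assume "u \<in> ?L"
    then obtain t s where ext: "u \<in> extensional (Delta d n)" and t: "t \<in> hom_markov_tree_shift d A"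
      and s: "s \<in> tree_words d" and ts: "\<And>w. w \<in> Delta d n \<Longrightarrow> t (s @ w) = u w"
      unfolding tree_blocks_def block_appears_def by blast
    have mem: "u w \<in> {..<dim_row A}" if "w \<in> Delta d n" for w
    proof -
      have "t \<in> tree_words d \<rightarrow>\<^sub>E {..<dim_row A}"
        using t by (simp add: hom_markov_tree_shift_def)
      moreover have "s @ w \<in> tree_words d" using s that by (simp add: Delta_def)
      ultimately show ?thesis using ts[OF that] PiE_mem by metis
    qed
    have edge: "R (u w) (u (w @ [c]))" if w: "w \<in> tree_words d" "length w < n" "c < d" for w c
    proof -
      have "R (t v) (t (v @ [c]))" if "v \<in> tree_words d" for v
        using t that w(3) by (simp add: hom_markov_tree_shift_def R_def)
      from this[of "s @ w"] have "R (t (s @ w)) (t ((s @ w) @ [c]))" using s w(1) by simp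
      moreover have "w \<in> Delta d n" using w by (simp add: Delta_def)
      ultimately show ?thesis using ts[of w] ts[OF snoc_in_Delta[OF w]] by simp
    qed
    have "u \<in> rooted_blocks d {..<dim_row A} R n (u [])"
      using ext mem edge by (auto simp: rooted_blocks_def PiE_def)
    then show "u \<in> ?U" using mem[of "[]"] by (intro UN_I[of "u []"]) auto
  qed
  show "?U \<subseteq> ?L"
  proof
    fix u assume "u \<in> ?U"
    then have u: "u \<in> Delta d n \<rightarrow>\<^sub>E {..<dim_row A}"
      and edge: "\<And>w c. w \<in> tree_words d \<Longrightarrow> length w < n \<Longrightarrow> c < d \<Longrightarrow> R (u w) (u (w @ [c]))"
      by (auto simp: rooted_blocks_def)
    obtain f where f: "\<And>i. i < dim_row A \<Longrightarrow> f i < dim_row A \<and> R i (f i)"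
      using succ unfolding R_def by metis
    define t where "t = (\<lambda>w\<in>tree_words d. (f ^^ (length w - n)) (u (take n w)))"
    have iter: "(f ^^ m) i < dim_row A" if "i < dim_row A" for m i
      using that f by (induction m) auto
    have take_mem: "take n w \<in> Delta d n" if "w \<in> tree_words d" for w
      using that by (auto simp: Delta_def dest: in_set_takeD)
    have t_mem: "t w < dim_row A" if "w \<in> tree_words d" for w
      using that iter u take_mem by (auto simp: t_def)
    have t_edge: "R (t w) (t (w @ [c]))" if w: "w \<in> tree_words d" "c < d" for w c
    proof (cases "length w < n")
      case True
      then show ?thesis using edge w by (simp add: t_def)
    next
      case False
      then have "t (w @ [c]) = f (t w)" using w by (simp add: t_def Suc_diff_le)
      then show ?thesis using f t_mem[OF w(1)] by simp
    qed
    have "t \<in> hom_markov_tree_shift d A"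
      using t_mem t_edge by (auto simp: hom_markov_tree_shift_def R_def t_def)
    moreover have "block_appears d n u t"
      unfolding block_appears_def
      by (rule bexI[of _ "[]"]) (auto simp: t_def Delta_def)
    ultimately show "u \<in> ?L" using u by (auto simp: tree_blocks_def PiE_def)
  qed
qed

lemma card_tree_blocks:
  assumes succ: "\<forall>i<dim_row A. \<exists>j<dim_row A. A $$ (i, j) = 1"
  shows "real (card (tree_blocks d n (hom_markov_tree_shift d A)))
    = (\<Sum>i<dim_row A. block_count d {..<dim_row A} (\<lambda>i j. of_bool (A $$ (i, j) = 1)) n i)"
proof -
  have "card (tree_blocks d n (hom_markov_tree_shift d A))
      = (\<Sum>i<dim_row A. card (rooted_blocks d {..<dim_row A} (\<lambda>i j. A $$ (i, j) = 1) n i))"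
    unfolding tree_blocks_eq[OF succ]
    by (rule card_UN_disjoint) (auto intro: finite_rooted_blocks dest: rooted_blocks_root)
  then show ?thesis by (simp add: card_rooted_blocks)
qed

section \<open>Counting words of the Markov shift\<close>

text \<open>Walks with \<open>n\<close> steps, as lists of their \<open>n + 1\<close> vertices.\<close>

primrec walks :: "'a set \<Rightarrow> ('a \<Rightarrow> 'a \<Rightarrow> bool) \<Rightarrow> nat \<Rightarrow> 'a \<Rightarrow> 'a list set" where
  "walks I R 0 = (\<lambda>i. {[i]})"
| "walks I R (Suc n) = (\<lambda>i. \<Union>j\<in>{j\<in>I. R i j}. (#) i ` walks I R n j)"

lemma hd_walks: "xs \<in> walks I R n i \<Longrightarrow> xs \<noteq> [] \<and> hd xs = i"
  by (cases n) auto

lemma finite_walks: "finite I \<Longrightarrow> finite (walks I R n i)"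
  by (induction n arbitrary: i) auto

lemma card_walks:
  assumes fin: "finite I"
  shows "real (card (walks I R n i)) = block_count 1 I (\<lambda>i j. of_bool (R i j)) n i"
proof (induction n arbitrary: i)
  case (Suc n)
  let ?S = "{j\<in>I. R i j}"
  have "card (walks I R (Suc n) i) = (\<Sum>j\<in>?S. card ((#) i ` walks I R n j))"
    unfolding walks.simps
    using fin by (intro card_UN_disjoint) (auto intro: finite_walks dest!: hd_walks)
  also have "\<dots> = (\<Sum>j\<in>?S. card (walks I R n j))"
    by (intro sum.cong refl card_image) simp
  finally have "real (card (walks I R (Suc n) i)) = (\<Sum>j\<in>?S. block_count 1 I (\<lambda>i j. of_bool (R i j)) n j)"
    by (simp add: Suc.IH)
  also have "\<dots> = (\<Sum>j\<in>I. of_bool (R i j) * block_count 1 I (\<lambda>i j. of_bool (R i j)) n j)"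
    using fin by (intro sum.mono_neutral_cong_left) auto
  finally show ?case by simp
qed simp

text \<open>
  Prepending a predecessor to a sequence of the shift, and dropping its first symbol, match the
  recursion for walks. For \<open>n = 0\<close> some sequence starting with \<open>i\<close> has to exist, and iterating
  a successor function provides one.
\<close>

lemma shift_blocks_from:
  assumes succ: "\<forall>i<dim_row A. \<exists>j<dim_row A. A $$ (i, j) = 1"
  shows "i < dim_row A \<Longrightarrow> shift_blocks (Suc n) {x \<in> markov_shift A. x 0 = i}
    = walks {..<dim_row A} (\<lambda>i j. A $$ (i, j) = 1) n i"
proof (induction n arbitrary: i)
  case 0
  obtain f where f: "\<And>i. i < dim_row A \<Longrightarrow> f i < dim_row A \<and> A $$ (i, f i) = 1"
    using succ by metis
  define x where "x m = (f ^^ m) i" for m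
  have "x m < dim_row A" for m using 0 f by (induction m) (auto simp: x_def)
  then have "x \<in> {x \<in> markov_shift A. x 0 = i}"
    using f by (auto simp: markov_shift_def x_def)
  then show ?case by (auto simp: shift_blocks_def image_iff intro: exI[of _ x])
next
  case (Suc n)
  have map_Suc: "map x [0..<Suc (Suc n)] = x 0 # map (x \<circ> Suc) [0..<Suc n]" for x :: "nat \<Rightarrow> nat"
    by (simp add: upt_conv_Cons map_Suc_upt[symmetric] del: upt_Suc)
  show ?case (is "?L = ?W")
  proof
    show "?L \<subseteq> ?W"
    proof
      fix xs assume "xs \<in> ?L"
      then obtain x where x: "x \<in> markov_shift A" "x 0 = i" and xs: "xs = map x [0..<Suc (Suc n)]"
        by (auto simp: shift_blocks_def)
      have "x \<circ> Suc \<in> markov_shift A" "x 1 < dim_row A" "A $$ (i, x 1) = 1"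
        using x by (auto simp: markov_shift_def)
      moreover from this have "map (x \<circ> Suc) [0..<Suc n]
          \<in> shift_blocks (Suc n) {y \<in> markov_shift A. y 0 = x 1}"
        unfolding shift_blocks_def by (intro imageI) (simp add: comp_def)
      ultimately show "xs \<in> ?W" using Suc.IH[of "x 1"] x by (auto simp: xs map_Suc simp del: upt_Suc)
    qed
    show "?W \<subseteq> ?L"
    proof
      fix xs assume "xs \<in> ?W"
      then obtain j ys where j: "j < dim_row A" "A $$ (i, j) = 1"
        and "ys \<in> walks {..<dim_row A} (\<lambda>i j. A $$ (i, j) = 1) n j" and xs: "xs = i # ys" by auto
      then obtain y where y: "y \<in> markov_shift A" "y 0 = j" and ys: "ys = map y [0..<Suc n]"
        using Suc.IH[of j] by (auto simp: shift_blocks_def)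
      define x where "x = case_nat i y"
      have "x \<in> {x \<in> markov_shift A. x 0 = i}"
        using y j Suc.prems by (auto simp: markov_shift_def x_def Pi_iff split: nat.split)
      moreover have "x \<circ> Suc = y" by (auto simp: x_def)
      then have "xs = map x [0..<Suc (Suc n)]"
        unfolding map_Suc by (simp add: xs ys x_def)
      ultimately show "xs \<in> ?L" unfolding shift_blocks_def by blast
    qed
  qed
qed

lemma card_shift_blocks:
  assumes succ: "\<forall>i<dim_row A. \<exists>j<dim_row A. A $$ (i, j) = 1"
  shows "real (card (shift_blocks (Suc n) (markov_shift A)))
    = (\<Sum>i<dim_row A. block_count 1 {..<dim_row A} (\<lambda>i j. of_bool (A $$ (i, j) = 1)) n i)"
proof -
  let ?W = "walks {..<dim_row A} (\<lambda>i j. A $$ (i, j) = 1) n"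
  have "markov_shift A = (\<Union>i<dim_row A. {x \<in> markov_shift A. x 0 = i})"
    by (auto simp: markov_shift_def)
  then have "shift_blocks (Suc n) (markov_shift A)
      = (\<Union>i<dim_row A. shift_blocks (Suc n) {x \<in> markov_shift A. x 0 = i})"
    unfolding shift_blocks_def by (metis image_UN)
  also have "\<dots> = (\<Union>i<dim_row A. ?W i)" by (simp add: shift_blocks_from[OF succ])
  finally have "card (shift_blocks (Suc n) (markov_shift A)) = (\<Sum>i<dim_row A. card (?W i))"
    by (simp only:) (rule card_UN_disjoint, auto intro: finite_walks dest: hd_walks)
  then show ?thesis by (simp add: card_walks)
qed

section \<open>The entropy comparison\<close>

lemma pow_mat_pos_imp_path:
  fixes A :: "nat mat"
  assumes A: "A \<in> carrier_mat k k" and "i < k" "j < k" "(A ^\<^sub>m n) $$ (i, j) > 0"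
  shows "(i, j) \<in> {(i, j). i < k \<and> j < k \<and> A $$ (i, j) \<noteq> 0} ^^ n"
  using assms(3,4)
proof (induction n arbitrary: j)
  case 0
  then show ?case using A assms(2) by (auto split: if_splits)
next
  case (Suc n)
  have P: "A ^\<^sub>m n \<in> carrier_mat k k" using A by simp
  have "(A ^\<^sub>m Suc n) $$ (i, j) = (\<Sum>l = 0..<k. (A ^\<^sub>m n) $$ (i, l) * A $$ (l, j))"
    using A P assms(2) Suc.prems(1) by (simp add: scalar_prod_def)
  then have "\<exists>l\<in>{0..<k}. (A ^\<^sub>m n) $$ (i, l) * A $$ (l, j) \<noteq> 0"
    using Suc.prems(2) sum.neutral[of "{0..<k}" "\<lambda>l. (A ^\<^sub>m n) $$ (i, l) * A $$ (l, j)"]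
    by (metis less_irrefl)
  then obtain l where "l < k" "(A ^\<^sub>m n) $$ (i, l) * A $$ (l, j) \<noteq> 0" by auto
  then show ?case using Suc.IH[of l] Suc.prems(1) by auto
qed

lemma irreducible_matrix_weights:
  fixes A :: "nat mat"
  assumes A: "A \<in> carrier_mat k k" and k: "k \<ge> 1"
    and bin: "\<And>i j. i < k \<Longrightarrow> j < k \<Longrightarrow> A $$ (i, j) \<in> {0, 1}"
    and irr: "irreducible_matrix A"
  shows "irreducible_weights {..<k} (\<lambda>i j. of_bool (A $$ (i, j) = 1))"
proof -
  define E where "E = {(i, j). i < k \<and> j < k \<and> A $$ (i, j) \<noteq> 0}"
  have E: "A $$ (i, j) = 1" "i < k" "j < k" if "(i, j) \<in> E" for i j
    using that bin[of i j] by (auto simp: E_def)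
  have path: "(i, j) \<in> E\<^sup>+" if ij: "i < k" "j < k" for i j
  proof -
    have "dim_row A = k" using A by simp
    then obtain n where n: "n \<ge> 1" "(A ^\<^sub>m n) $$ (i, j) > 0"
      using irr ij unfolding irreducible_matrix_def by blast
    then have "(i, j) \<in> E ^^ n" unfolding E_def by (intro pow_mat_pos_imp_path[OF A ij])
    then show ?thesis unfolding trancl_power using n by (intro exI[of _ n]) simp
  qed
  show ?thesis
  proof (rule irreducible_weights.intro)
    show "finite {..<k}" by simp
    show "{..<k} \<noteq> {}" using k by (auto simp: lessThan_empty_iff)
    show "\<exists>j\<in>{..<k}. (0::real) < of_bool (A $$ (i, j) = 1)" if i: "i \<in> {..<k}" for i
    proof -
      obtain j where "(i, j) \<in> E" using tranclD[OF path[of i i]] i by auto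
      from E[OF this] show ?thesis by (intro bexI[of _ j]) auto
    qed
    show "\<exists>i\<in>{..<k}. (0::real) < of_bool (A $$ (i, j) = 1)" if j: "j \<in> {..<k}" for j
    proof -
      obtain i where "(i, j) \<in> E" using tranclD2[OF path[of j j]] j by auto
      from E[OF this] show ?thesis by (intro bexI[of _ i]) auto
    qed
    show "\<exists>i\<in>S. \<exists>j\<in>{..<k} - S. (0::real) < of_bool (A $$ (i, j) = 1)"
      if S: "S \<subset> {..<k}" "S \<noteq> {}" for S
    proof (rule ccontr)
      assume no: "\<not> ?thesis"
      obtain i j where i: "i \<in> S" and j: "j < k" "j \<notin> S" using S by blast
      have closed: "y \<in> S" if "x \<in> S" "(x, y) \<in> E" for x y
        using no that E[OF that(2)] by force
      have "(i, j) \<in> E\<^sup>+" using path i j S by blast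
      then have "j \<in> S" by (induction rule: trancl_induct) (use i closed in blast)+
      then show False using j by simp
    qed
  qed simp
qed

text \<open>
  The shift entropy is \<open>ln c\<close>, so the two entropies agree exactly if the tree counts grow at rate
  \<open>ln c\<close>, that is, if all row sums equal \<open>c\<close>; constant row sums can only have the value \<open>c\<close>,
  by pairing with the left eigenvector.
\<close>

theorem theorem2p1:
  fixes d k M m :: nat and A :: "nat mat"
  assumes "d \<ge> 2" and "k \<ge> 1"
    and "A \<in> carrier_mat k k"
    and "\<And>i j. i < k \<Longrightarrow> j < k \<Longrightarrow> A $$ (i, j) \<in> {0, 1}"
    and "irreducible_matrix A"
    and "M = (MAX i\<in>{..<k}. \<Sum>j<k. A $$ (i, j))"
    and "m = (MIN i\<in>{..<k}. \<Sum>j<k. A $$ (i, j))"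
  shows "shift_entropy (markov_shift A) = tree_entropy d (hom_markov_tree_shift d A) \<longleftrightarrow> M = m"
proof -
  define a :: "nat \<Rightarrow> nat \<Rightarrow> real" where "a = (\<lambda>i j. of_bool (A $$ (i, j) = 1))"
  define s where "s i = (\<Sum>j<k. A $$ (i, j))" for i
  have dim: "dim_row A = k" using assms(3) by simp
  have weights: "irreducible_weights {..<k} a"
    unfolding a_def using assms by (intro irreducible_matrix_weights) auto
  obtain c r l where "Perron_weights {..<k} a c r l"
    using irreducible_weights.Perron_weights_exist[OF weights] by blast
  then interpret Perron_tree "{..<k}" a c r l d
    using assms(1) by (intro Perron_tree.intro Perron_tree_axioms.intro)
  have rows: "(\<Sum>j<k. a i j) = real (s i)" if "i < k" for i
    unfolding s_def of_nat_sum
  proof (rule sum.cong[OF refl])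
    show "a i j = real (A $$ (i, j))" if "j \<in> {..<k}" for j
      using assms(4)[of i j] that \<open>i < k\<close> by (auto simp: a_def)
  qed
  have succ: "\<forall>i<dim_row A. \<exists>j<dim_row A. A $$ (i, j) = 1"
    using row by (auto simp: dim a_def)
  have "(\<lambda>n. ln (real (card (shift_blocks (Suc n) (markov_shift A)))) / real (Suc n)) \<longlonglongrightarrow> ln c"
    unfolding card_shift_blocks[OF succ] using word_growth by (simp only: dim a_def)
  then have shift: "shift_entropy (markov_shift A) = ln c"
    unfolding shift_entropy_def by (intro limI) (rule LIMSEQ_imp_Suc)
  have rate: "ln (real (card (tree_blocks d n (hom_markov_tree_shift d A)))) / real (card (Delta d n))
      = ln (total d n) / (D n + 1)" for n
    unfolding card_tree_blocks[OF succ] card_Delta by (simp only: dim a_def)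
  obtain h where h: "(\<lambda>n. ln (total d n) / (D n + 1)) \<longlonglongrightarrow> h"
    using tree_growth_exists by (auto simp: convergent_def)
  then have "tree_entropy d (hom_markov_tree_shift d A) = h"
    unfolding tree_entropy_def rate by (rule limI)
  then have "shift_entropy (markov_shift A) = tree_entropy d (hom_markov_tree_shift d A)
      \<longleftrightarrow> (\<lambda>n. ln (total d n) / (D n + 1)) \<longlonglongrightarrow> ln c"
    using h shift LIMSEQ_unique by metis
  also have "\<dots> \<longleftrightarrow> (\<forall>i<k. (\<Sum>j<k. a i j) = c)"
    using tree_growth_eq_iff by auto
  also have "\<dots> \<longleftrightarrow> (\<forall>i<k. real (s i) = c)"
    using rows by simp
  also have "\<dots> \<longleftrightarrow> M = m"
  proof
    assume const: "\<forall>i<k. real (s i) = c"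
    have eq_first: "s i = s 0" if "i < k" for i
    proof -
      have "real (s i) = c" "real (s 0) = c" using const that by auto
      then show ?thesis by simp
    qed
    have "s ` {..<k} = (\<lambda>_. s 0) ` {..<k}" by (intro image_cong refl eq_first) simp
    also have "\<dots> = {s 0}" using assms(2) by (intro image_constant[of 0]) simp
    finally have "s ` {..<k} = {s 0}" .
    then show "M = m" by (simp add: assms(6,7) s_def[symmetric])
  next
    assume "M = m"
    have eq: "s i = M" if "i < k" for i
    proof (rule antisym)
      show "s i \<le> M" using that by (simp add: assms(6) s_def)
      have "m \<le> s i" using that by (simp add: assms(7) s_def)
      then show "M \<le> s i" using \<open>M = m\<close> by simp
    qed
    then have "real M = c" using rows by (intro constant_row_sum) simp
    then show "\<forall>i<k. real (s i) = c" using eq by simp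
  qed
  finally show ?thesis .
qed

end
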